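(* Let $q$ be an odd prime power with $q\equiv 1\pmod 3$, let $m=(q-1)/3$, and let $\gamma$ be a generator of the multiplicative group $\mathbf{F}_q^*$. For each $k\in\{0,1,\dots,m-1\}$, define elements $a,b,c\in\mathbf{F}_q$ by $$a=\frac{\gamma^{2m}+\gamma^{m+6k+2}+\gamma^{3k+1}}{3\gamma^{m+3k+1}},\qquad b=\frac{\gamma^{2m+3k+1}+\gamma^{m+6k+2}+1}{3\gamma^{m+3k+1}},\qquad c=\frac{\gamma^{6k+2}+\gamma^{3k+1}+1}{3\gamma^{3k+1}}.$$ Then the polynomial $g(x)=ax^{2m+1}+bx^{m+1}+cx$ is a permutation polynomial over $\mathbf{F}_q$, and the permutation of $\mathbf{F}_q$ it induces is an involution with exactly $m+1$ fixed points.
   Context: $\mathbf{F}_q$ denotes the finite field with $q$ elements. A permutation polynomial over $\mathbf{F}_q$ is a polynomial $g\in\mathbf{F}_q[x]$ whose associated map $\mathbf{F}_q\to\mathbf{F}_q$, $x\mapsto g(x)$, is a bijection; it is involutory if $g(g(x))=x$ for all $x\in\mathbf{F}_q$. *)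

theory Defs
  imports
    "HOL-Computational_Algebra.Polynomial"
    "HOL-Library.Cardinality"
    "HOL-Number_Theory.Cong"
    "HOL-Number_Theory.Prime_Powers"
begin

definition mult_generator :: "'a::field \<Rightarrow> bool" where
  "mult_generator \<gamma> \<longleftrightarrow> range (\<lambda>i::int. \<gamma> powi i) = UNIV - {0}"

definition permutation_poly :: "'a::{field,finite} poly \<Rightarrow> bool" where
  "permutation_poly g \<longleftrightarrow> bij (poly g)"

definition involutory_poly :: "'a::{field,finite} poly \<Rightarrow> bool" where
  "involutory_poly g \<longleftrightarrow> (\<forall>x. poly g (poly g x) = x)"

end

theory Submission imports Defs begin

text \<open>Put \<open>w = \<gamma> ^ m\<close>, a primitive cube root of unity, and \<open>u = \<gamma> ^ (3 * k + 1)\<close>, so \<open>u ^ m = w\<close>.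
  Then \<open>g x = x * h (x ^ m)\<close> where \<open>h\<close> is the quadratic with \<open>h 1 = u\<close>, \<open>h w = 1 / u\<close> and
  \<open>h (w\<^sup>2) = 1\<close>. Hence \<open>g\<close> maps the coset \<open>x ^ m = 1\<close> to the coset \<open>x ^ m = w\<close> by multiplication
  with \<open>u\<close>, maps the latter back by division by \<open>u\<close>, and fixes \<open>0\<close> together with the \<open>m\<close> elements of
  the coset \<open>x ^ m = w\<^sup>2\<close>. Such a coset has exactly \<open>m\<close> elements because \<open>x \<mapsto> x ^ m\<close> sends the \<open>3 * m\<close>
  nonzero elements to at most three cube roots of unity, with equally large fibres of at most \<open>m\<close>
  elements each.\<close>

(* finite_field_power_card_eq_same is not applicable: the sort {field, finite} does not imply
   the class finite_field. *)
lemma finite_field_power_card_minus_1: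
  fixes x :: "'a::{field,finite}"
  assumes "x \<noteq> 0"
  shows "x ^ (CARD('a) - 1) = 1"
proof -
  have "\<Prod>(UNIV - {0}) = (\<Prod>y\<in>UNIV - {0}. x * y)"
    by (rule prod.reindex_bij_witness[of _ "\<lambda>y. x * y" "\<lambda>y. y / x"]) (use assms in auto)
  also have "\<dots> = x ^ (CARD('a) - 1) * \<Prod>(UNIV - {0})"
    by (simp add: prod.distrib card_Diff_singleton)
  finally show ?thesis
    by simp
qed

lemma card_roots_of_unity_le:
  assumes "n > 0"
  shows "card {x :: 'a::idom. x ^ n = 1} \<le> n"
proof -
  let ?p = "monom 1 n - 1 :: 'a poly"
  have "coeff ?p n = 1"
    using assms by simp
  then have "?p \<noteq> 0"
    by (metis coeff_0 zero_neq_one)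
  then have "card {x. poly ?p x = 0} \<le> degree ?p"
    by (rule card_poly_roots_bound)
  also have "\<dots> \<le> n"
    by (rule degree_diff_le) (simp_all add: degree_monom_le)
  finally show ?thesis
    by (simp add: poly_monom)
qed

lemma card_power_fibre:
  fixes y :: "'a::field"
  assumes "y \<noteq> 0"
  shows "card {x. x ^ n = y ^ n} = card {x :: 'a. x ^ n = 1}"
proof -
  have "bij_betw (\<lambda>x. x / y) {x. x ^ n = y ^ n} {x. x ^ n = 1}"
    by (rule bij_betwI[where g = "\<lambda>x. x * y"]) (use assms in \<open>auto simp: field_simps\<close>)
  then show ?thesis
    by (rule bij_betw_same_card)
qed

lemma card_nth_powers_times_card_roots_of_unity:
  assumes "n > 0"
  shows "card ((\<lambda>x. x ^ n) ` (UNIV - {0 :: 'a::{field,finite}})) *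
    card {x :: 'a. x ^ n = 1} = CARD('a) - 1"
proof -
  let ?S = "UNIV - {0 :: 'a}"
  have fibre: "card {x \<in> ?S. x ^ n = z} = card {x :: 'a. x ^ n = 1}"
    if "z \<in> (\<lambda>x. x ^ n) ` ?S" for z
  proof -
    from that obtain y where "y \<noteq> 0" "z = y ^ n"
      by blast
    then have "{x \<in> ?S. x ^ n = z} = {x. x ^ n = y ^ n}"
      using assms by (auto simp: zero_power)
    then show ?thesis
      using card_power_fibre[OF \<open>y \<noteq> 0\<close>] by simp
  qed
  have "CARD('a) - 1 = card ?S"
    by (simp add: card_Diff_singleton)
  also have "\<dots> = (\<Sum>z\<in>(\<lambda>x. x ^ n) ` ?S. card {x \<in> ?S. x ^ n = z})"
    using sum.image_gen[of ?S "\<lambda>_. 1 :: nat" "\<lambda>x. x ^ n"] by simp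
  also have "\<dots> = (\<Sum>z\<in>(\<lambda>x. x ^ n) ` ?S. card {x :: 'a. x ^ n = 1})"
    by (rule sum.cong) (simp_all only: fibre)
  finally show ?thesis
    by simp
qed

lemma card_roots_of_unity_finite_field:
  assumes "CARD('a::{field,finite}) - 1 = d * n"
  shows "card {x :: 'a. x ^ n = 1} = n"
proof (rule antisym)
  let ?P = "(\<lambda>x. x ^ n) ` (UNIV - {0 :: 'a})"
  have "card {0, 1 :: 'a} \<le> CARD('a)"
    by (rule card_mono) simp_all
  then have "d > 0" "n > 0"
    using assms by (auto intro!: Nat.gr0I)
  show "card {x :: 'a. x ^ n = 1} \<le> n"
    using \<open>n > 0\<close> by (rule card_roots_of_unity_le)
  have "?P \<subseteq> {z. z ^ d = 1}"
  proof clarify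
    fix x :: 'a
    assume "x \<noteq> 0"
    then show "(x ^ n) ^ d = 1"
      using finite_field_power_card_minus_1[of x] unfolding assms
      by (simp add: mult.commute flip: power_mult)
  qed
  then have "card ?P \<le> card {z :: 'a. z ^ d = 1}"
    by (rule card_mono[rotated]) simp
  also have "\<dots> \<le> d"
    using \<open>d > 0\<close> by (rule card_roots_of_unity_le)
  finally have "card ?P * card {x :: 'a. x ^ n = 1} \<le> d * card {x :: 'a. x ^ n = 1}"
    by (rule mult_le_mono1)
  then have "d * n \<le> d * card {x :: 'a. x ^ n = 1}"
    using card_nth_powers_times_card_roots_of_unity[OF \<open>n > 0\<close>, where 'a = 'a] assms by simp
  then show "n \<le> card {x :: 'a. x ^ n = 1}"
    using \<open>d > 0\<close> by simp
qed

lemma mult_generator_nonzero: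
  assumes "mult_generator (\<gamma> :: 'a::field)"
  shows "\<gamma> \<noteq> 0"
proof -
  have "\<gamma> powi 1 \<in> UNIV - {0}"
    using assms unfolding mult_generator_def by blast
  then show ?thesis
    by simp
qed

lemma mult_generator_power_neq_1:
  fixes \<gamma> :: "'a::{field,finite}"
  assumes "mult_generator \<gamma>" "0 < n" "n < CARD('a) - 1"
  shows "\<gamma> ^ n \<noteq> 1"
proof
  assume "\<gamma> ^ n = 1"
  have "UNIV - {0 :: 'a} \<subseteq> {x. x ^ n = 1}"
  proof
    fix x :: 'a
    assume "x \<in> UNIV - {0}"
    then obtain i where "x = \<gamma> powi i"
      using assms(1) unfolding mult_generator_def by blast
    then have "x ^ n = (\<gamma> ^ n) powi i"
      by (simp add: power_int_power power_int_power' mult.commute)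
    with \<open>\<gamma> ^ n = 1\<close> show "x \<in> {x. x ^ n = 1}"
      by simp
  qed
  then have "card (UNIV - {0 :: 'a}) \<le> card {x :: 'a. x ^ n = 1}"
    by (rule card_mono[rotated]) simp
  also have "\<dots> \<le> n"
    using assms(2) by (rule card_roots_of_unity_le)
  finally show False
    using assms(3) by (simp add: card_Diff_singleton)
qed

lemma sum_powers_cube_root_of_unity:
  fixes w :: "'a::idom"
  assumes "w ^ 3 = 1" "w \<noteq> 1"
  shows "1 + w + w\<^sup>2 = 0"
proof -
  have "(w - 1) * (1 + w + w\<^sup>2) = w ^ 3 - 1"
    by algebra
  with assms show ?thesis
    by simp
qed

lemma cube_root_of_unity_imp_three_neq_0:
  fixes w :: "'a::idom"
  assumes "w ^ 3 = 1" "w \<noteq> 1"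
  shows "(3 :: 'a) \<noteq> 0"
proof
  assume "(3 :: 'a) = 0"
  moreover have "(w - 1)\<^sup>2 = (1 + w + w\<^sup>2) - 3 * w"
    by algebra
  ultimately show False
    using assms by (simp add: sum_powers_cube_root_of_unity)
qed

lemma cube_roots_of_unity:
  fixes w z :: "'a::idom"
  assumes "w ^ 3 = 1" "w \<noteq> 1" "z ^ 3 = 1"
  obtains "z = 1" | "z = w" | "z = w\<^sup>2"
proof -
  have "(z - 1) * (z - w) * (z - w\<^sup>2) = 0"
    using assms(1,3) sum_powers_cube_root_of_unity[OF assms(1,2)] by algebra
  with that show ?thesis
    by auto
qed

(* The inverse discrete Fourier transform of length 3. *)
definition cube_root_interpolant :: "'a::field \<Rightarrow> 'a \<Rightarrow> 'a \<Rightarrow> 'a \<Rightarrow> 'a poly" where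
  "cube_root_interpolant w y\<^sub>0 y\<^sub>1 y\<^sub>2 =
     smult (1 / 3) [:y\<^sub>0 + y\<^sub>1 + y\<^sub>2, y\<^sub>0 + y\<^sub>1 * w\<^sup>2 + y\<^sub>2 * w, y\<^sub>0 + y\<^sub>1 * w + y\<^sub>2 * w\<^sup>2:]"

lemma poly_cube_root_interpolant:
  fixes w :: "'a::field"
  assumes "w ^ 3 = 1" "w \<noteq> 1"
  shows "poly (cube_root_interpolant w y\<^sub>0 y\<^sub>1 y\<^sub>2) 1 = y\<^sub>0"
    and "poly (cube_root_interpolant w y\<^sub>0 y\<^sub>1 y\<^sub>2) w = y\<^sub>1"
    and "poly (cube_root_interpolant w y\<^sub>0 y\<^sub>1 y\<^sub>2) (w\<^sup>2) = y\<^sub>2"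
proof -
  let ?h = "[:y\<^sub>0 + y\<^sub>1 + y\<^sub>2, y\<^sub>0 + y\<^sub>1 * w\<^sup>2 + y\<^sub>2 * w, y\<^sub>0 + y\<^sub>1 * w + y\<^sub>2 * w\<^sup>2:]"
  have "poly ?h 1 = 3 * y\<^sub>0" "poly ?h w = 3 * y\<^sub>1" "poly ?h (w\<^sup>2) = 3 * y\<^sub>2"
    unfolding poly_pCons poly_0
    using assms(1) sum_powers_cube_root_of_unity[OF assms] by algebra+
  then show "poly (cube_root_interpolant w y\<^sub>0 y\<^sub>1 y\<^sub>2) 1 = y\<^sub>0"
    and "poly (cube_root_interpolant w y\<^sub>0 y\<^sub>1 y\<^sub>2) w = y\<^sub>1"
    and "poly (cube_root_interpolant w y\<^sub>0 y\<^sub>1 y\<^sub>2) (w\<^sup>2) = y\<^sub>2"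
    using cube_root_of_unity_imp_three_neq_0[OF assms]
    by (simp_all only: cube_root_interpolant_def poly_smult) simp_all
qed

lemma cube_root_interpolant_inverse_pair:
  fixes u w :: "'a::field"
  assumes "w ^ 3 = 1" "w \<noteq> 1" "u \<noteq> 0"
  shows "cube_root_interpolant w u (1 / u) 1 =
    [:(u\<^sup>2 + u + 1) / (3 * u), (w\<^sup>2 * u + w * u\<^sup>2 + 1) / (3 * (w * u)),
      (w\<^sup>2 + w * u\<^sup>2 + u) / (3 * (w * u)):]"
proof -
  have "w \<noteq> 0"
    using assms(1) by auto
  have "w * (w * w) = 1"
    using assms(1) by (simp add: power3_eq_cube mult.assoc)
  then show ?thesis
    using cube_root_of_unity_imp_three_neq_0[OF assms(1,2)] \<open>w \<noteq> 0\<close> assms(3)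
    by (simp add: cube_root_interpolant_def field_simps power2_eq_square)
qed

definition cyclotomic_map :: "nat \<Rightarrow> ('a::comm_monoid_mult \<Rightarrow> 'a) \<Rightarrow> 'a \<Rightarrow> 'a" where
  "cyclotomic_map n f x = x * f (x ^ n)"

lemma cyclotomic_map_cyclotomic_map:
  "cyclotomic_map n f (cyclotomic_map n f x) = x * (f (x ^ n) * f (x ^ n * f (x ^ n) ^ n))"
  by (simp add: cyclotomic_map_def power_mult_distrib mult.assoc)

lemma cyclotomic_map_eq_self_iff:
  fixes x :: "'a::idom"
  shows "cyclotomic_map n f x = x \<longleftrightarrow> x = 0 \<or> f (x ^ n) = 1"
  by (simp add: cyclotomic_map_def)

lemma poly_trinomial_eq_cyclotomic_map:
  fixes a b c :: "'a::comm_semiring_1"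
  shows "poly (monom a (2 * n + 1) + monom b (n + 1) + monom c 1) =
    cyclotomic_map n (poly [:c, b, a:])"
  by (rule ext) (simp add: cyclotomic_map_def poly_monom algebra_simps mult_2_right power_add)

locale cube_coset_swap =
  fixes w u :: "'a::{field,finite}" and m :: nat
  assumes card_minus_1: "CARD('a) - 1 = 3 * m"
    and w_cubed: "w ^ 3 = 1"
    and w_neq_1: "w \<noteq> 1"
    and u_power: "u ^ m = w"
begin

definition swap :: "'a \<Rightarrow> 'a" where
  "swap = cyclotomic_map m (poly (cube_root_interpolant w u (1 / u) 1))"

lemmas multiplier_values = poly_cube_root_interpolant[OF w_cubed w_neq_1, of u "1 / u" 1]

lemma m_pos: "m > 0"
  using u_power w_neq_1 by (auto intro: Nat.gr0I)

lemma u_nonzero: "u \<noteq> 0"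
  using u_power w_cubed m_pos by (auto simp: zero_power)

lemma power_cases:
  assumes "x \<noteq> 0"
  obtains "x ^ m = 1" | "x ^ m = w" | "x ^ m = w\<^sup>2"
proof (rule cube_roots_of_unity[OF w_cubed w_neq_1])
  show "(x ^ m) ^ 3 = 1"
    using finite_field_power_card_minus_1[OF assms] unfolding card_minus_1
    by (simp add: mult.commute flip: power_mult)
qed

lemma swap_swap: "swap (swap x) = x"
proof (cases "x = 0")
  case True
  then show ?thesis
    by (simp add: swap_def cyclotomic_map_def)
next
  case False
  then show ?thesis
    unfolding swap_def cyclotomic_map_cyclotomic_map
    using u_nonzero u_power w_cubed
    by (cases rule: power_cases) (auto simp: multiplier_values power_divide)
qed

lemma swap_eq_self_iff: "swap x = x \<longleftrightarrow> x = 0 \<or> x ^ m = w\<^sup>2"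
proof (cases "x = 0")
  case False
  have "u \<noteq> 1" "w\<^sup>2 \<noteq> 1" "w\<^sup>2 \<noteq> w"
    using u_power w_cubed w_neq_1 by (auto simp: power2_eq_square power3_eq_cube)
  with False show ?thesis
    unfolding swap_def cyclotomic_map_eq_self_iff
    by (cases rule: power_cases) (auto simp: multiplier_values)
qed (simp add: swap_def cyclotomic_map_def)

lemma card_fixed_points: "card {x. swap x = x} = m + 1"
proof -
  have "(u\<^sup>2) ^ m = w\<^sup>2"
    by (simp add: mult.commute flip: u_power power_mult)
  then have "{x. swap x = x} = insert 0 {x. x ^ m = (u\<^sup>2) ^ m}"
    by (auto simp: swap_eq_self_iff)
  moreover have "card {x. x ^ m = (u\<^sup>2) ^ m} = m"
    using u_nonzero card_roots_of_unity_finite_field[OF card_minus_1]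
    by (simp add: card_power_fibre)
  moreover have "0 \<notin> {x. x ^ m = (u\<^sup>2) ^ m}"
    using u_nonzero m_pos by (simp add: zero_power)
  ultimately show ?thesis
    by simp
qed

end

lemma cube_coset_swap_generator_powers:
  fixes \<gamma> :: "'a::{field,finite}"
  assumes gen: "mult_generator \<gamma>" and card: "CARD('a) - 1 = 3 * m" and "m > 0"
  shows "cube_coset_swap (\<gamma> ^ m) (\<gamma> ^ (3 * k + 1)) m"
proof
  have order: "\<gamma> ^ (3 * m) = 1"
    using finite_field_power_card_minus_1[OF mult_generator_nonzero[OF gen]] unfolding card .
  then show "(\<gamma> ^ m) ^ 3 = 1"
    by (simp add: mult.commute flip: power_mult)
  show "\<gamma> ^ m \<noteq> 1"
    using mult_generator_power_neq_1[OF gen] card \<open>m > 0\<close> by simp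
  have "(\<gamma> ^ (3 * k + 1)) ^ m = \<gamma> ^ (3 * m * k + m)"
    by (simp add: algebra_simps flip: power_mult power_add)
  also have "\<dots> = \<gamma> ^ m"
    by (simp only: power_add power_mult[of _ "3 * m" k] order) simp
  finally show "(\<gamma> ^ (3 * k + 1)) ^ m = \<gamma> ^ m" .
qed (fact card)

theorem theorem2p3:
  fixes q m k :: nat and \<gamma> a b c :: "'a::{field,finite}" and g :: "'a poly"
  assumes "q = CARD('a)" and "primepow q" and "odd q" and "[q = 1] (mod 3)"
    and "m = (q - 1) div 3"
    and "mult_generator \<gamma>"
    and "k \<in> {0..<m}"
    and "a = (\<gamma> ^ (2*m) + \<gamma> ^ (m + 6*k + 2) + \<gamma> ^ (3*k + 1)) / (3 * \<gamma> ^ (m + 3*k + 1))"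
    and "b = (\<gamma> ^ (2*m + 3*k + 1) + \<gamma> ^ (m + 6*k + 2) + 1) / (3 * \<gamma> ^ (m + 3*k + 1))"
    and "c = (\<gamma> ^ (6*k + 2) + \<gamma> ^ (3*k + 1) + 1) / (3 * \<gamma> ^ (3*k + 1))"
    and "g = monom a (2*m + 1) + monom b (m + 1) + monom c 1"
  shows "permutation_poly g \<and> involutory_poly g \<and> card {x. poly g x = x} = m + 1"
proof -
  define w u where "w = \<gamma> ^ m" and "u = \<gamma> ^ (3*k + 1)"
  have "CARD('a) - 1 = 3 * m" "m > 0"
    using assms(1,4,5,7) by (auto simp: cong_def, presburger)
  then interpret cube_coset_swap w u m
    unfolding w_def u_def by (rule cube_coset_swap_generator_powers[OF assms(6)])
  have powers: "\<gamma> ^ (2*m) = w\<^sup>2" "\<gamma> ^ (6*k + 2) = u\<^sup>2" "\<gamma> ^ (m + 3*k + 1) = w * u"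
    "\<gamma> ^ (2*m + 3*k + 1) = w\<^sup>2 * u" "\<gamma> ^ (m + 6*k + 2) = w * u\<^sup>2"
    by (simp_all add: w_def u_def algebra_simps flip: power_add power_mult power_Suc power_Suc2)
  have "[:c, b, a:] = cube_root_interpolant w u (1 / u) 1"
    unfolding cube_root_interpolant_inverse_pair[OF w_cubed w_neq_1 u_nonzero]
      assms(8-10) powers by (simp add: u_def)
  then have "poly g = swap"
    unfolding assms(11) swap_def poly_trinomial_eq_cyclotomic_map by simp
  moreover have "bij swap"
    by (rule involuntory_imp_bij) (rule swap_swap)
  ultimately show ?thesis
    by (simp add: permutation_poly_def involutory_poly_def swap_swap card_fixed_points)
qed

end
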